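(* Let $(\xi_k)_{k\ge 1}$ be a decreasing (not necessarily strictly decreasing) sequence of positive real numbers, and let $\mathbf{R}\colon \ell^2\to\ell^2$ be the associated affine isometry defined in the context. For every integer $n\ge1$ set $$s_n := 1+\sum_{m=1}^{n-1}\lceil m/2\rceil\,(m+2)!.$$ If $n\ge 8$, then $$3(n-7)\xi_{n+2}^2 \;\le\; 3\sum_{k=10}^{n+2}\xi_k^2 \;\le\; \|\mathbf{R}^{s_n}0\|^2 \;<\; 4\sum_{k=1}^{n+2}\xi_k^2+\frac{\pi^2\xi_{n+3}^2}{(n+3)^2-1} \;\le\; 4(n+2)\xi_1^2+\frac{\pi^2\xi_{n+3}^2}{(n+3)^2-1}.$$ Consequently, the following implications hold: $$\lim_{k\to\infty}\xi_k>0 \;\Rightarrow\; (\xi_k)_{k\ge1}\notin\ell^2 \;\Rightarrow\; \|\mathbf{R}^{s_n}0\|\to\infty \text{ as } n\to\infty,$$ and $$\lim_{k\to\infty}\xi_k>0 \;\Rightarrow\; \|\mathbf{R}^{s_n}0\| = O\big(\sqrt{n}\,\big) \text{ as } n\to\infty.$$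
   Context: $\ell^2$ denotes the real Hilbert space of square-summable real sequences; as the domain of $\mathbf{R}$ it is viewed as the set of sequences $\mathbf{x}=(x_1,x_2,\ldots)$ with each $x_k\in\mathbb{R}^2$ and $\|\mathbf{x}\|^2=\sum_{k\ge1}\|x_k\|^2<\infty$ (Euclidean norm on each $\mathbb{R}^2$). The condition $(\xi_k)_{k\ge1}\notin\ell^2$ means $\sum_{k\ge1}\xi_k^2=\infty$. For each integer $k\ge 1$, set $\theta_k = 2\pi/k!$ and define $R_k\colon\mathbb{R}^2\to\mathbb{R}^2$ by $$R_k x = \begin{pmatrix}\cos\theta_k & -\sin\theta_k\\ \sin\theta_k & \cos\theta_k\end{pmatrix}x + \xi_k\begin{pmatrix}1-\cos\theta_k\\ -\sin\theta_k\end{pmatrix}.$$ Define $\mathbf{R}(x_1,x_2,\ldots,x_k,\ldots) = (R_1x_1,R_2x_2,\ldots,R_kx_k,\ldots)$. Since $(\xi_k)_{k\geq 1}$ is positive and decreasing, $\mathbf{R}$ maps $\ell^2$ into $\ell^2$ and is an affine isometry. $\mathbf{R}^{m}$ denotes the $m$-fold composition of $\mathbf{R}$ with itself, $0$ is the zero vector of $\ell^2$, and $\lceil\cdot\rceil$ is the ceiling function. *)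

theory Defs
  imports "HOL-Analysis.Analysis" "HOL-Library.Landau_Symbols"
begin

text \<open>
  Sequences are indexed by \<open>k \<ge> 1\<close>; the value at index \<open>0\<close> is ignored throughout.
  The same definition of \<open>\<ell>\<^sup>2\<close> serves for scalar sequences and for sequences in the plane.
\<close>

definition ell2 :: "(nat \<Rightarrow> 'a::real_normed_vector) set"
  where "ell2 = {x. (\<lambda>k. (norm (x k))\<^sup>2) summable_on {1..}}"

definition ell2_norm :: "(nat \<Rightarrow> 'a::real_normed_vector) \<Rightarrow> real"
  where "ell2_norm x = sqrt (\<Sum>\<^sub>\<infinity>k\<in>{1..}. (norm (x k))\<^sup>2)"

definition theta :: "nat \<Rightarrow> real"
  where "theta k = 2 * pi / fact k"

definition R_comp :: "(nat \<Rightarrow> real) \<Rightarrow> nat \<Rightarrow> real^2 \<Rightarrow> real^2"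
  where "R_comp \<xi> k x =
    (vector [vector [cos (theta k), - sin (theta k)],
             vector [sin (theta k),   cos (theta k)]] :: real^2^2) *v x
    + \<xi> k *\<^sub>R vector [1 - cos (theta k), - sin (theta k)]"

definition R_op :: "(nat \<Rightarrow> real) \<Rightarrow> (nat \<Rightarrow> real^2) \<Rightarrow> (nat \<Rightarrow> real^2)"
  where "R_op \<xi> x = (\<lambda>k. R_comp \<xi> k (x k))"

definition s_num :: "nat \<Rightarrow> nat"
  where "s_num n = 1 + (\<Sum>m = 1..n - 1. nat \<lceil>real m / 2\<rceil> * fact (m + 2))"

text \<open>
  For a positive decreasing \<open>\<xi>\<close>, the map \<open>R_op \<xi>\<close> is an affine isometry of \<open>ell2\<close>.
  In particular all iterates of the zero sequence are in \<open>ell2\<close>, so the value of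
  \<open>ell2_norm\<close> at them is a convergent sum.
\<close>

lemma R_comp_diff:
  "norm (R_comp \<xi> k x - R_comp \<xi> k y) = norm (x - y)"
proof -
  have *: "(c * u - d * v)\<^sup>2 + (d * u + c * v)\<^sup>2 = (d\<^sup>2 + c\<^sup>2) * (u\<^sup>2 + v\<^sup>2)" for c d u v :: real
    by (simp add: power2_eq_square algebra_simps)
  define z where "z = x - y"
  have "R_comp \<xi> k x - R_comp \<xi> k y =
      vector [cos (theta k) * z $ 1 - sin (theta k) * z $ 2,
              sin (theta k) * z $ 1 + cos (theta k) * z $ 2]"
    by (simp add: vec_eq_iff forall_2 R_comp_def matrix_vector_mult_def sum_2 z_def algebra_simps)
  then show ?thesis
    using *[of "cos (theta k)" "z $ 1" "sin (theta k)" "z $ 2"]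
    by (simp add: norm_vec_def L2_set_def sum_2 flip: z_def)
qed

lemma R_op_isometry:
  "ell2_norm (\<lambda>k. R_op \<xi> x k - R_op \<xi> y k) = ell2_norm (\<lambda>k. x k - y k)"
  by (simp add: ell2_norm_def R_op_def R_comp_diff)

lemma R_op_affine:
  "R_op \<xi> (\<lambda>k. (1 - t) *\<^sub>R x k + t *\<^sub>R y k) =
     (\<lambda>k. (1 - t) *\<^sub>R R_op \<xi> x k + t *\<^sub>R R_op \<xi> y k)"
  by (simp add: fun_eq_iff vec_eq_iff forall_2 R_op_def R_comp_def
      matrix_vector_mult_def sum_2 algebra_simps)

lemma ell2_add:
  assumes "x \<in> ell2" "y \<in> ell2"
  shows "(\<lambda>k. x k + y k) \<in> ell2"
proof -
  have "(\<lambda>k. 2 * (norm (x k))\<^sup>2 + 2 * (norm (y k))\<^sup>2) summable_on {1..}"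
    using assms unfolding ell2_def
    by (intro summable_on_add summable_on_cmult_right) auto
  moreover have "(norm (x k + y k))\<^sup>2 \<le> 2 * (norm (x k))\<^sup>2 + 2 * (norm (y k))\<^sup>2" for k
  proof -
    have "(norm (x k + y k))\<^sup>2 \<le> (norm (x k) + norm (y k))\<^sup>2"
      by (intro power_mono norm_triangle_ineq) auto
    also have "\<dots> \<le> 2 * (norm (x k))\<^sup>2 + 2 * (norm (y k))\<^sup>2"
      using sum_squares_bound[of "norm (x k)" "norm (y k)"] by (simp add: power2_sum)
    finally show ?thesis .
  qed
  ultimately show ?thesis
    unfolding ell2_def mem_Collect_eq
    by (intro summable_on_comparison_test[where g = "\<lambda>k. (norm (x k + y k))\<^sup>2"]) auto
qed

lemma R_op_zero_in_ell2:
  assumes pos: "\<forall>k\<ge>1. \<xi> k > 0" and dec: "antimono_on {1..} \<xi>"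
  shows "R_op \<xi> (\<lambda>_. 0) \<in> ell2"
proof -
  have le: "(norm (R_op \<xi> (\<lambda>_. 0) k))\<^sup>2 \<le> (2 * pi * \<xi> 1)\<^sup>2 * inverse (fact k)"
    if k: "k \<in> {1..}" for k
  proof -
    have "(norm (R_op \<xi> (\<lambda>_. 0) k))\<^sup>2 =
        (\<xi> k * (1 - cos (theta k)))\<^sup>2 + (\<xi> k * sin (theta k))\<^sup>2"
      by (simp add: norm_vec_def L2_set_def sum_2 R_comp_def R_op_def)
    also have "\<dots> = (\<xi> k)\<^sup>2 * (2 * sin (theta k / 2))\<^sup>2"
    proof -
      define t where "t = theta k / 2"
      have c: "cos (2 * t) = 1 - 2 * (sin t)\<^sup>2"
        by (simp add: cos_double_sin)
      have "(1 - cos (2 * t))\<^sup>2 + (sin (2 * t))\<^sup>2 = 2 - 2 * cos (2 * t)"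
        using sin_cos_squared_add[of "2 * t"] by (simp add: power2_eq_square algebra_simps)
      also have "\<dots> = (2 * sin t)\<^sup>2"
        unfolding c by (simp add: power2_eq_square)
      finally show ?thesis
        by (simp add: t_def power_mult_distrib flip: distrib_left)
    qed
    also have "\<dots> \<le> (\<xi> 1)\<^sup>2 * (theta k)\<^sup>2"
    proof (intro mult_mono)
      have "0 < \<xi> k" "\<xi> k \<le> \<xi> 1"
        using pos dec k by (auto simp: monotone_on_def)
      then show "(\<xi> k)\<^sup>2 \<le> (\<xi> 1)\<^sup>2"
        by (intro power_mono) auto
      have "\<bar>2 * sin (theta k / 2)\<bar> \<le> \<bar>theta k\<bar>"
        using abs_sin_x_le_abs_x[of "theta k / 2"] by (simp add: abs_mult)
      then show "(2 * sin (theta k / 2))\<^sup>2 \<le> (theta k)\<^sup>2"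
        by (simp add: abs_le_square_iff)
    qed auto
    also have "\<dots> = (2 * pi * \<xi> 1)\<^sup>2 * (inverse (fact k) * inverse (fact k))"
      by (simp add: theta_def power2_eq_square field_simps)
    also have "\<dots> \<le> (2 * pi * \<xi> 1)\<^sup>2 * (inverse (fact k) * 1)"
      by (intro mult_left_mono) (auto simp: field_simps)
    finally show ?thesis by simp
  qed
  have "(\<lambda>k. inverse (fact k) :: real) summable_on UNIV"
    using summable_exp[of "1::real"] by (subst summable_on_UNIV_nonneg_real_iff) auto
  then have "(\<lambda>k. inverse (fact k) :: real) summable_on {1..}"
    using summable_on_subset_banach by blast
  then have "(\<lambda>k. (2 * pi * \<xi> 1)\<^sup>2 * inverse (fact k)) summable_on {1..}"
    by (rule summable_on_cmult_right)
  then show ?thesis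
    unfolding ell2_def mem_Collect_eq
    by (rule summable_on_comparison_test) (use le in auto)
qed

lemma R_op_in_ell2:
  assumes "\<forall>k\<ge>1. \<xi> k > 0" "antimono_on {1..} \<xi>" "x \<in> ell2"
  shows "R_op \<xi> x \<in> ell2"
proof -
  have "(\<lambda>k. R_op \<xi> x k - R_op \<xi> (\<lambda>_. 0) k) \<in> ell2"
    using assms(3) by (simp add: ell2_def R_op_def R_comp_diff)
  from ell2_add[OF this R_op_zero_in_ell2[OF assms(1,2)]] show ?thesis
    by simp
qed

lemma R_op_iterate_in_ell2:
  assumes "\<forall>k\<ge>1. \<xi> k > 0" "antimono_on {1..} \<xi>" "x \<in> ell2"
  shows "(R_op \<xi> ^^ m) x \<in> ell2"
  by (induction m) (use assms in \<open>auto intro: R_op_in_ell2\<close>)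

end

theory Submission
  imports Defs
begin

text \<open>
  In coordinate \<open>k\<close> the operator rotates the plane by the angle \<open>theta k = 2\<pi>/k!\<close> about the
  point \<open>(\<xi> k, 0)\<close>, which lies at distance \<open>\<xi> k\<close> from the origin. After \<open>m\<close> steps the origin has
  therefore moved along a chord of squared length
  \<open>2 (1 - cos (2\<pi> m/k!)) (\<xi> k)\<^sup>2\<close> (\<open>norm_R_op_iterate_zero\<close>), and \<open>\<parallel>\<^bold>R\<^sup>m 0\<parallel>\<^sup>2\<close> is the sum
  of these numbers. Everything depends on the position of \<open>m\<close> relative to the factorials.

  The times \<open>s n\<close> satisfy \<open>s (n + 1) = s n + \<lceil>n/2\<rceil> (n + 2)!\<close>. Two consequences carry the proof.
  The ratio \<open>s n / (n + 2)!\<close> stays between \<open>1/3\<close> and \<open>1/2\<close> from \<open>n = 4\<close> on: adding roughly half of the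
  \<open>n + 3\<close> copies of \<open>(n + 2)!\<close> that make up \<open>(n + 3)!\<close> keeps it there
  (\<open>s_num_lower\<close>, \<open>s_num_upper\<close>). And all later increments are multiples of
  \<open>(n + 2)!\<close>, so they are full turns in coordinate \<open>n + 2\<close> and below (\<open>s_num_cong_fact\<close>).

  Hence at time \<open>s n\<close> each coordinate \<open>k\<close> with \<open>10 \<le> k \<le> n + 2\<close> is turned, up to full
  turns, by an angle in \<open>[2\<pi>/3, \<pi>]\<close> and contributes at least \<open>3 (\<xi> k)\<^sup>2\<close>
  (\<open>displacement_s_num_ge_3\<close>). For the upper bound, coordinates up to \<open>n + 2\<close> contribute at
  most the squared diameter \<open>4 (\<xi> k)\<^sup>2\<close>, and beyond them the angle is so small that
  \<open>2 (1 - cos t) \<le> t\<^sup>2\<close> gives a geometric tail of ratio \<open>1/(n + 3)\<^sup>2\<close>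
  (\<open>displacement_s_num_tail\<close>); its sum is the correction term with denominator
  \<open>(n + 3)\<^sup>2 - 1\<close>. Divergence and the \<open>O(\<surd>n)\<close> rate are read off from these two bounds.
\<close>

section \<open>The orbit of the origin under a single rotation\<close>

lemma R_op_iterate_component:
  "(R_op \<xi> ^^ m) x k = (R_comp \<xi> k ^^ m) (x k)"
  by (induction m) (auto simp: R_op_def)

lemma R_comp_iterate_zero:
  "(R_comp \<xi> k ^^ m) 0 =
     \<xi> k *\<^sub>R vector [1 - cos (real m * theta k), - sin (real m * theta k)]"
proof (induction m)
  case 0
  then show ?case by (simp add: vec_eq_iff forall_2)
next
  case (Suc m)
  have angle: "real (Suc m) * theta k = real m * theta k + theta k"
    by (simp add: algebra_simps)
  show ?case
    unfolding funpow.simps o_apply Suc.IH angle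
    by (simp add: vec_eq_iff forall_2 R_comp_def matrix_vector_mult_def sum_2
        cos_add sin_add algebra_simps)
qed

text \<open>
  The squared length of the chord that subtends the angle \<open>m * theta k\<close> in the unit circle:
  how far \<open>m\<close> rotations move a point at distance 1 from the centre.
\<close>
definition displacement :: "nat \<Rightarrow> nat \<Rightarrow> real"
  where "displacement m k = 2 * (1 - cos (real m * theta k))"

lemma norm_R_op_iterate_zero:
  "(norm ((R_op \<xi> ^^ m) (\<lambda>_. 0) k))\<^sup>2 = displacement m k * (\<xi> k)\<^sup>2"
proof -
  define t where "t = real m * theta k"
  have "(norm ((R_op \<xi> ^^ m) (\<lambda>_. 0) k))\<^sup>2 = (\<xi> k * (1 - cos t))\<^sup>2 + (\<xi> k * sin t)\<^sup>2"
    by (simp add: R_op_iterate_component R_comp_iterate_zero t_def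
        norm_vec_def L2_set_def sum_2)
  also have "\<dots> = (\<xi> k)\<^sup>2 * (1 - 2 * cos t + ((sin t)\<^sup>2 + (cos t)\<^sup>2))"
    by algebra
  finally show ?thesis
    by (simp add: displacement_def t_def)
qed

lemma displacement_nonneg: "0 \<le> displacement m k"
  by (simp add: displacement_def)

lemma displacement_le_4: "displacement m k \<le> 4"
proof -
  have "2 * (1 - c) \<le> 4" if "- 1 \<le> c" for c :: real
    using that by simp
  then show ?thesis
    unfolding displacement_def using cos_ge_minus_one by blast
qed

text \<open>
  The first coordinate is rotated by full turns only. This lost contribution is what makes the
  upper bound on the norm strict.
\<close>
lemma displacement_1: "displacement m 1 = 0"
  using cos_2npi[of m] by (simp add: displacement_def theta_def mult_ac)

text \<open>The chord is no longer than its arc.\<close>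
lemma displacement_le_square: "displacement m k \<le> (real m * theta k)\<^sup>2"
proof -
  define t where "t = real m * theta k / 2"
  have "displacement m k = (2 * sin t)\<^sup>2"
    using cos_double_sin[of t] by (simp add: displacement_def t_def power_mult_distrib)
  also have "\<dots> \<le> (2 * t)\<^sup>2"
    using abs_sin_x_le_abs_x[of t] by (simp add: abs_le_square_iff[symmetric] abs_mult)
  finally show ?thesis by (simp add: t_def)
qed

lemma displacement_add_multiple_fact:
  "displacement (r + q * fact k) k = displacement r k"
proof -
  have "real (r + q * fact k) * theta k = real r * theta k + 2 * real q * pi"
    by (simp add: theta_def field_simps)
  then show ?thesis
    by (simp only: displacement_def cos_add cos_2npi sin_2npi) simp
qed

text \<open>
  The hypotheses say that the angle lies in \<open>[2\<pi>/3, \<pi>]\<close>, where the cosine is at most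
  \<open>- 1/2\<close>.
\<close>
lemma displacement_ge_3:
  assumes "fact k \<le> 3 * m" "2 * m \<le> fact k"
  shows "3 \<le> displacement m k"
proof -
  have "real (fact k) \<le> real (3 * m)" "real (2 * m) \<le> real (fact k)"
    using assms by (simp_all only: of_nat_le_iff)
  then have *: "fact k \<le> 3 * real m" "2 * real m \<le> fact k" by simp_all
  have "2 * pi / 3 \<le> real m * theta k"
    using mult_left_mono[OF *(1), of pi] by (simp add: theta_def field_simps)
  moreover have "real m * theta k \<le> pi"
    using mult_left_mono[OF *(2), of pi] by (simp add: theta_def field_simps)
  ultimately have "cos (real m * theta k) \<le> cos (2 * pi / 3)"
    by (intro cos_monotone_0_pi_le) auto
  then show ?thesis
    by (simp add: displacement_def cos_120)
qed

section \<open>Size and residues of the iteration times\<close>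

lemma s_num_Suc: "s_num (Suc n) = s_num n + ((n + 1) div 2) * fact (n + 2)"
proof (cases n)
  case 0
  then show ?thesis by (simp add: s_num_def)
next
  case (Suc p)
  have "n \<le> 2 * ((n + 1) div 2)" "2 * ((n + 1) div 2) \<le> n + 1"
    by presburger+
  then have "\<lceil>real n / 2\<rceil> = int ((n + 1) div 2)"
    by (intro ceiling_unique) linarith+
  then have "nat \<lceil>real n / 2\<rceil> = (n + 1) div 2"
    by simp
  then show ?thesis
    by (simp add: s_num_def Suc)
qed

text \<open>
  Since \<open>(n + 3)! = (n + 3) (n + 2)!\<close>, an increment of at most \<open>(n + 1)/2\<close> copies of
  \<open>(n + 2)!\<close> leaves room for the half copy that the induction hypothesis allows for \<open>s n\<close>.
\<close>
lemma s_num_upper: "2 * s_num n \<le> fact (n + 2)"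
proof (induction n)
  case 0
  then show ?case by (simp add: s_num_def)
next
  case (Suc n)
  have "2 * ((n + 1) div 2) \<le> n + 1" by simp
  then have "2 * ((n + 1) div 2) * fact (n + 2) \<le> (n + 1) * (fact (n + 2) :: nat)"
    by (rule mult_right_mono) simp
  moreover have "(fact (Suc n + 2) :: nat) = (n + 3) * fact (n + 2)"
    by (simp add: algebra_simps)
  ultimately show ?case
    using Suc by (simp add: s_num_Suc algebra_simps)
qed

text \<open>
  If \<open>s n\<close> is at least a third of \<open>(n + 2)!\<close>, then \<open>s (n + 1)\<close> is at least
  \<open>\<lceil>n/2\<rceil> + 1/3\<close> copies of \<open>(n + 2)!\<close>, which is a third of \<open>n + 3\<close> copies as soon as
  \<open>3 \<lceil>n/2\<rceil> \<ge> n + 2\<close>. The ratio first exceeds \<open>1/3\<close> for good at \<open>n = 4\<close>, where it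
  is \<open>271/720\<close>.
\<close>
lemma s_num_lower:
  assumes "4 \<le> n"
  shows "fact (n + 2) \<le> 3 * s_num n"
  using assms
proof (induction n rule: dec_induct)
  case base
  have "s_num 2 = 7"
    using s_num_Suc[of 1] by (simp add: s_num_def[of "Suc 0"] numeral_eq_Suc)
  then have "s_num 4 = 271"
    using s_num_Suc[of 2] s_num_Suc[of 3] by (simp add: fact_numeral)
  then show ?case by (simp add: fact_numeral)
next
  case (step n)
  have "n + 2 \<le> 3 * ((n + 1) div 2)" using step.hyps by linarith
  then have "(n + 2) * fact (n + 2) \<le> 3 * ((n + 1) div 2) * (fact (n + 2) :: nat)"
    by (rule mult_right_mono) simp
  moreover have "(fact (Suc n + 2) :: nat) = (n + 3) * fact (n + 2)"
    by (simp add: algebra_simps)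
  ultimately show ?case
    using step.IH by (simp add: s_num_Suc algebra_simps)
qed

text \<open>
  Every increment between \<open>s j\<close> and \<open>s n\<close> is a multiple of a factorial that \<open>(j + 2)!\<close>
  divides, so in coordinate \<open>j + 2\<close> the times \<open>s j\<close> and \<open>s n\<close> are indistinguishable.
\<close>
lemma s_num_cong_fact:
  assumes "j \<le> n"
  shows "\<exists>q. s_num n = s_num j + q * fact (j + 2)"
  using assms
proof (induction n rule: dec_induct)
  case base
  show ?case by (rule exI[of _ 0]) simp
next
  case (step n)
  then obtain q where q: "s_num n = s_num j + q * fact (j + 2)" by blast
  have "(fact (j + 2) :: nat) dvd fact (n + 2)"
    using step.hyps by (intro fact_dvd) simp
  then obtain c where "(fact (n + 2) :: nat) = fact (j + 2) * c" by (elim dvdE)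
  then have "s_num (Suc n) = s_num j + (q + ((n + 1) div 2) * c) * fact (j + 2)"
    unfolding s_num_Suc q by (simp only: algebra_simps)
  then show ?case by blast
qed

section \<open>Contribution of each coordinate\<close>

text \<open>
  At time \<open>s n\<close> coordinate \<open>k\<close> is where it was at time \<open>s (k - 2)\<close>, which lies between a third
  and a half of its period \<open>k!\<close>.
\<close>
lemma displacement_s_num_ge_3:
  assumes "10 \<le> k" "k \<le> n + 2"
  shows "3 \<le> displacement (s_num n) k"
proof -
  define j where "j = k - 2"
  have j: "8 \<le> j" "j \<le> n" "k = j + 2" using assms by (auto simp: j_def)
  obtain q where "s_num n = s_num j + q * fact k"
    using s_num_cong_fact[OF j(2)] j(3) by auto
  then have "displacement (s_num n) k = displacement (s_num j) k"
    by (simp only: displacement_add_multiple_fact)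
  then show ?thesis
    using displacement_ge_3 s_num_lower[of j] j(1) s_num_upper[of j] j(3) by simp
qed

lemma fact_mult_power_le_fact: "fact a * (a + 1) ^ i \<le> (fact (a + i) :: nat)"
proof (induction i)
  case (Suc i)
  have "fact a * (a + 1) ^ Suc i \<le> fact (a + i) * (a + i + 1)"
    using mult_le_mono[OF Suc, of "a + 1" "a + i + 1"] by (simp add: algebra_simps)
  then show ?case by (simp add: algebra_simps)
qed simp

text \<open>
  From \<open>2 s n \<le> (n + 2)!\<close> the angle \<open>2\<pi> s n / k!\<close> is at most \<open>\<pi> (n + 2)!/k!\<close>, and each step
  from \<open>(n + 2)!\<close> up to \<open>k!\<close> multiplies by at least \<open>n + 3\<close>. Bounding the chord by the arc
  squares these factors.
\<close>
lemma displacement_s_num_tail: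
  "displacement (s_num n) (i + (n + 3)) \<le> pi\<^sup>2 * (1 / (real n + 3)\<^sup>2) ^ Suc i"
proof -
  have "fact (n + 2) * (n + 3) ^ Suc i \<le> (fact (i + (n + 3)) :: nat)"
    using fact_mult_power_le_fact[of "n + 2" "Suc i"] by (simp add: add_ac numeral_eq_Suc)
  then have "2 * s_num n * (n + 3) ^ Suc i \<le> fact (i + (n + 3))"
    using mult_right_mono[OF s_num_upper[of n], of "(n + 3) ^ Suc i"] by linarith
  then have "real (2 * s_num n * (n + 3) ^ Suc i) \<le> real (fact (i + (n + 3)))"
    by (simp only: of_nat_le_iff)
  then have le: "2 * real (s_num n) * (real n + 3) ^ Suc i \<le> fact (i + (n + 3))"
    by simp
  have quotient: "a / b \<le> 1 / c" if "a * c \<le> b" "0 < b" "0 < c" for a b c :: real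
    using that by (simp add: divide_simps)
  have "2 * real (s_num n) / fact (i + (n + 3)) \<le> 1 / (real n + 3) ^ Suc i"
    by (rule quotient[OF le]) auto
  then have "pi * (2 * real (s_num n) / fact (i + (n + 3))) \<le> pi * (1 / (real n + 3) ^ Suc i)"
    by (intro mult_left_mono) auto
  moreover have "real (s_num n) * theta (i + (n + 3)) = pi * (2 * real (s_num n) / fact (i + (n + 3)))"
    by (simp add: theta_def)
  ultimately have "real (s_num n) * theta (i + (n + 3)) \<le> pi * (1 / (real n + 3) ^ Suc i)"
    by (simp only:)
  then have "(real (s_num n) * theta (i + (n + 3)))\<^sup>2 \<le> (pi * (1 / (real n + 3) ^ Suc i))\<^sup>2"
    by (rule power_mono) (simp add: theta_def)
  also have "\<dots> = pi\<^sup>2 * (1 / (real n + 3)\<^sup>2) ^ Suc i"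
    by (simp only: power_mult_distrib power_divide power_one flip: power_mult)
       (simp only: mult.commute)
  finally show ?thesis
    using displacement_le_square order_trans by blast
qed

section \<open>The norm of the orbit\<close>

lemma ell2_norm_square_sums:
  fixes x :: "nat \<Rightarrow> 'a::real_normed_vector"
  assumes "x \<in> ell2"
  shows "(\<lambda>k. (norm (x (Suc k)))\<^sup>2) sums (ell2_norm x)\<^sup>2"
proof -
  have "((\<lambda>k. (norm (x k))\<^sup>2) has_sum (ell2_norm x)\<^sup>2) {1..}"
    using assms by (simp add: ell2_def ell2_norm_def infsum_nonneg)
  moreover have "bij_betw Suc UNIV {1..}"
    by (auto simp: bij_betw_def image_iff Suc_le_eq gr0_conv_Suc)
  ultimately have "((\<lambda>k. (norm (x (Suc k)))\<^sup>2) has_sum (ell2_norm x)\<^sup>2) UNIV"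
    by (subst has_sum_reindex_bij_betw) 
  then show ?thesis by (rule has_sum_imp_sums)
qed

lemma positive_antimono_square_le:
  fixes \<xi> :: "nat \<Rightarrow> real"
  assumes "\<forall>k\<ge>1. \<xi> k > 0" "antimono_on {1..} \<xi>" "1 \<le> j" "j \<le> k"
  shows "(\<xi> k)\<^sup>2 \<le> (\<xi> j)\<^sup>2"
proof (rule power_mono)
  show "\<xi> k \<le> \<xi> j" using assms by (auto simp: monotone_on_def)
  show "0 \<le> \<xi> k" using assms by (simp add: less_imp_le)
qed

text \<open>
  The upper and lower bounds both treat the coordinates up to \<open>n + 2\<close> and the remaining ones
  differently, so the norm is cut there into a finite sum and a convergent series.
\<close>
lemma ell2_norm_orbit_split:
  assumes "\<forall>k\<ge>1. \<xi> k > 0" "antimono_on {1..} \<xi>"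
  defines "f \<equiv> \<lambda>m k. displacement m k * (\<xi> k)\<^sup>2"
  shows "summable (\<lambda>i. f m (i + Suc N))"
    and "(ell2_norm ((R_op \<xi> ^^ m) (\<lambda>_. 0)))\<^sup>2 = (\<Sum>k = 1..N. f m k) + (\<Sum>i. f m (i + Suc N))"
proof -
  have "(\<lambda>_. 0 :: real^2) \<in> ell2" by (simp add: ell2_def)
  then have "(R_op \<xi> ^^ m) (\<lambda>_. 0) \<in> ell2"
    using assms by (intro R_op_iterate_in_ell2) auto
  from ell2_norm_square_sums[OF this]
  have sums: "(\<lambda>k. f m (Suc k)) sums (ell2_norm ((R_op \<xi> ^^ m) (\<lambda>_. 0)))\<^sup>2"
    by (simp only: norm_R_op_iterate_zero f_def)
  then show "summable (\<lambda>i. f m (i + Suc N))"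
    using summable_iff_shift[of "\<lambda>k. f m (Suc k)" N] by (simp add: sums_iff)
  show "(ell2_norm ((R_op \<xi> ^^ m) (\<lambda>_. 0)))\<^sup>2 = (\<Sum>k = 1..N. f m k) + (\<Sum>i. f m (i + Suc N))"
    using suminf_split_initial_segment[of "\<lambda>k. f m (Suc k)" N] sums
    by (simp add: sums_iff sum.atLeast1_atMost_eq)
qed

lemma ell2_norm_orbit_lower:
  assumes "\<forall>k\<ge>1. \<xi> k > 0" "antimono_on {1..} \<xi>"
  shows "3 * (\<Sum>k = 10..n + 2. (\<xi> k)\<^sup>2) \<le> (ell2_norm ((R_op \<xi> ^^ s_num n) (\<lambda>_. 0)))\<^sup>2"
proof -
  let ?f = "\<lambda>k. displacement (s_num n) k * (\<xi> k)\<^sup>2"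
  have "3 * (\<Sum>k = 10..n + 2. (\<xi> k)\<^sup>2) \<le> (\<Sum>k = 10..n + 2. ?f k)"
    unfolding sum_distrib_left
    by (intro sum_mono mult_right_mono displacement_s_num_ge_3) auto
  also have "\<dots> \<le> (\<Sum>k = 1..n + 2. ?f k)"
    by (intro sum_mono2) (auto simp: displacement_nonneg)
  also have "\<dots> \<le> (ell2_norm ((R_op \<xi> ^^ s_num n) (\<lambda>_. 0)))\<^sup>2"
    using ell2_norm_orbit_split[OF assms, of "s_num n" "n + 2"]
    by (simp add: suminf_nonneg displacement_nonneg)
  finally show ?thesis .
qed

lemma ell2_norm_orbit_upper:
  assumes "\<forall>k\<ge>1. \<xi> k > 0" "antimono_on {1..} \<xi>"
  shows "(ell2_norm ((R_op \<xi> ^^ s_num n) (\<lambda>_. 0)))\<^sup>2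
    < 4 * (\<Sum>k = 1..n + 2. (\<xi> k)\<^sup>2) + pi\<^sup>2 * (\<xi> (n + 3))\<^sup>2 / ((real n + 3)\<^sup>2 - 1)"
proof -
  let ?f = "\<lambda>k. displacement (s_num n) k * (\<xi> k)\<^sup>2"
  have "0 < \<xi> 1" using assms by simp
  \<comment> \<open>The inequality is strict at \<open>k = 1\<close>, where the left-hand term vanishes.\<close>
  then have "(\<Sum>k = 1..n + 2. ?f k) < (\<Sum>k = 1..n + 2. 4 * (\<xi> k)\<^sup>2)"
    by (intro sum_strict_mono_ex1 bexI[of _ 1])
      (auto intro!: mult_right_mono displacement_le_4 simp: displacement_1[simplified])
  moreover have "(\<Sum>i. ?f (i + Suc (n + 2))) \<le> pi\<^sup>2 * (\<xi> (n + 3))\<^sup>2 / ((real n + 3)\<^sup>2 - 1)"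
  proof -
    define q where "q = 1 / (real n + 3)\<^sup>2"
    have gt: "1 < (real n + 3)\<^sup>2" by (intro one_less_power) auto
    then have q: "0 < q" "q < 1" by (auto simp: q_def)
    then have "(\<lambda>i. pi\<^sup>2 * (\<xi> (n + 3))\<^sup>2 * q * q ^ i) sums
        (pi\<^sup>2 * (\<xi> (n + 3))\<^sup>2 * q * (1 / (1 - q)))"
      by (intro sums_mult geometric_sums) simp
    moreover have "pi\<^sup>2 * (\<xi> (n + 3))\<^sup>2 * q * (1 / (1 - q)) = pi\<^sup>2 * (\<xi> (n + 3))\<^sup>2 / ((real n + 3)\<^sup>2 - 1)"
    proof -
      have "q * (1 / (1 - q)) = 1 / ((real n + 3)\<^sup>2 - 1)"
        unfolding q_def using gt by (simp add: divide_simps)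
      then show ?thesis by (metis mult.assoc mult.right_neutral times_divide_eq_right)
    qed
    ultimately have geom: "(\<lambda>i. pi\<^sup>2 * (\<xi> (n + 3))\<^sup>2 * q * q ^ i) sums
        (pi\<^sup>2 * (\<xi> (n + 3))\<^sup>2 / ((real n + 3)\<^sup>2 - 1))" by simp
    have "?f (i + Suc (n + 2)) \<le> pi\<^sup>2 * (\<xi> (n + 3))\<^sup>2 * q * q ^ i" for i
    proof -
      have "?f (i + (n + 3)) \<le> (pi\<^sup>2 * q ^ Suc i) * (\<xi> (n + 3))\<^sup>2"
      proof (rule mult_mono)
        show "displacement (s_num n) (i + (n + 3)) \<le> pi\<^sup>2 * q ^ Suc i"
          unfolding q_def by (rule displacement_s_num_tail)
        show "(\<xi> (i + (n + 3)))\<^sup>2 \<le> (\<xi> (n + 3))\<^sup>2"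
          by (rule positive_antimono_square_le[OF assms]) auto
      qed (use q in auto)
      then show ?thesis by (simp add: algebra_simps numeral_eq_Suc)
    qed
    then show ?thesis
      unfolding sums_unique[OF geom]
      by (rule suminf_le[OF _ ell2_norm_orbit_split(1)[OF assms] sums_summable[OF geom]])
  qed
  ultimately show ?thesis
    unfolding ell2_norm_orbit_split(2)[OF assms, of "s_num n" "n + 2"]
    by (simp add: sum_distrib_left)
qed

section \<open>Asymptotic consequences\<close>

lemma positive_limit_not_in_ell2:
  fixes \<xi> :: "nat \<Rightarrow> real"
  assumes "\<xi> \<longlonglongrightarrow> L" "0 < L"
  shows "\<xi> \<notin> ell2"
proof
  assume "\<xi> \<in> ell2"
  then have "summable (\<lambda>k. (norm (\<xi> (Suc k)))\<^sup>2)"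
    using ell2_norm_square_sums sums_summable by blast
  then have "(\<lambda>k. (norm (\<xi> (Suc k)))\<^sup>2) \<longlonglongrightarrow> 0" by (rule summable_LIMSEQ_zero)
  moreover have "(\<lambda>k. (norm (\<xi> (Suc k)))\<^sup>2) \<longlonglongrightarrow> (norm L)\<^sup>2"
    using assms(1) by (intro tendsto_intros) (rule LIMSEQ_Suc)
  ultimately show False
    using assms(2) LIMSEQ_unique by fastforce
qed

lemma not_ell2_partial_sums_unbounded:
  fixes \<xi> :: "nat \<Rightarrow> real"
  assumes "\<xi> \<notin> ell2"
  shows "\<exists>N. C < (\<Sum>k<N. (\<xi> k)\<^sup>2)"
proof (rule ccontr)
  assume "\<not> ?thesis"
  then have "summable (\<lambda>k. (\<xi> k)\<^sup>2)"
    by (intro bounded_imp_summable[where B = C])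
      (simp_all only: not_ex not_less zero_le_power2 flip: lessThan_Suc_atMost)
  then have "(\<lambda>k. (\<xi> k)\<^sup>2) summable_on UNIV"
    by (subst summable_on_UNIV_nonneg_real_iff) auto
  then have "(\<lambda>k. (\<xi> k)\<^sup>2) summable_on {1..}"
    by (rule summable_on_subset_banach) simp
  then show False using assms by (simp add: ell2_def)
qed

text \<open>
  The lower bound misses only the indices below 10, that is, a fixed amount, so the unbounded
  partial sums of \<open>(\<xi> k)\<^sup>2\<close> push the norm to infinity.
\<close>
lemma ell2_norm_orbit_at_top:
  assumes "\<forall>k\<ge>1. \<xi> k > 0" "antimono_on {1..} \<xi>" "\<xi> \<notin> ell2"
  shows "filterlim (\<lambda>n. ell2_norm ((R_op \<xi> ^^ s_num n) (\<lambda>_. 0))) at_top sequentially"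
  unfolding filterlim_at_top
proof
  fix Z :: real
  obtain N where N: "Z\<^sup>2 + (\<Sum>k<10. (\<xi> k)\<^sup>2) < (\<Sum>k<N. (\<xi> k)\<^sup>2)"
    using not_ell2_partial_sums_unbounded[OF assms(3)] by blast
  show "\<forall>\<^sub>F n in sequentially. Z \<le> ell2_norm ((R_op \<xi> ^^ s_num n) (\<lambda>_. 0))"
    unfolding eventually_sequentially
  proof (intro exI allI impI)
    fix n assume n: "max 8 N \<le> n"
    have "(\<Sum>k<N. (\<xi> k)\<^sup>2) \<le> (\<Sum>k<n + 3. (\<xi> k)\<^sup>2)"
      using n by (intro sum_mono2) auto
    also have "{..<n + 3} = {..<10} \<union> {10..n + 2}" using n by auto
    also have "(\<Sum>k\<in>\<dots>. (\<xi> k)\<^sup>2) = (\<Sum>k<10. (\<xi> k)\<^sup>2) + (\<Sum>k = 10..n + 2. (\<xi> k)\<^sup>2)"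
      by (rule sum.union_disjoint) auto
    finally have "Z\<^sup>2 \<le> (\<Sum>k = 10..n + 2. (\<xi> k)\<^sup>2)" using N by simp
    also have "\<dots> \<le> 3 * (\<Sum>k = 10..n + 2. (\<xi> k)\<^sup>2)" by (simp add: sum_nonneg)
    also have "\<dots> \<le> (ell2_norm ((R_op \<xi> ^^ s_num n) (\<lambda>_. 0)))\<^sup>2"
      by (rule ell2_norm_orbit_lower[OF assms(1,2)])
    finally show "Z \<le> ell2_norm ((R_op \<xi> ^^ s_num n) (\<lambda>_. 0))"
      by (rule power2_le_imp_le) (simp add: ell2_norm_def infsum_nonneg)
  qed
qed

lemma sum_squares_le_first:
  fixes \<xi> :: "nat \<Rightarrow> real"
  assumes "\<forall>k\<ge>1. \<xi> k > 0" "antimono_on {1..} \<xi>"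
  shows "(\<Sum>k = 1..N. (\<xi> k)\<^sup>2) \<le> real N * (\<xi> 1)\<^sup>2"
  using sum_bounded_above[of "{1..N}" "\<lambda>k. (\<xi> k)\<^sup>2" "(\<xi> 1)\<^sup>2"]
    positive_antimono_square_le[OF assms] by simp

text \<open>
  All terms are at most \<open>(\<xi> 1)\<^sup>2\<close>, so the upper bound grows linearly in \<open>n\<close>. The constant
  \<open>12 + \<pi>\<^sup>2\<close> comes from \<open>n + 2 \<le> 3 n\<close> and \<open>(n + 3)\<^sup>2 - 1 \<ge> 1\<close>, valid for \<open>n \<ge> 1\<close>.
\<close>
lemma ell2_norm_orbit_bigo:
  assumes "\<forall>k\<ge>1. \<xi> k > 0" "antimono_on {1..} \<xi>"
  shows "(\<lambda>n. ell2_norm ((R_op \<xi> ^^ s_num n) (\<lambda>_. 0))) \<in> O(\<lambda>n. sqrt (real n))"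
proof (rule bigoI[where c = "sqrt ((12 + pi\<^sup>2) * (\<xi> 1)\<^sup>2)"])
  show "\<forall>\<^sub>F n in sequentially. norm (ell2_norm ((R_op \<xi> ^^ s_num n) (\<lambda>_. 0)))
      \<le> sqrt ((12 + pi\<^sup>2) * (\<xi> 1)\<^sup>2) * norm (sqrt (real n))"
    using eventually_ge_at_top[of 1]
  proof eventually_elim
    case (elim n)
    have "(ell2_norm ((R_op \<xi> ^^ s_num n) (\<lambda>_. 0)))\<^sup>2
        \<le> 4 * (\<Sum>k = 1..n + 2. (\<xi> k)\<^sup>2) + pi\<^sup>2 * (\<xi> (n + 3))\<^sup>2 / ((real n + 3)\<^sup>2 - 1)"
      using ell2_norm_orbit_upper[OF assms] by (rule less_imp_le)
    also have "\<dots> \<le> 12 * real n * (\<xi> 1)\<^sup>2 + pi\<^sup>2 * (\<xi> 1)\<^sup>2 * real n"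
    proof (rule add_mono)
      have "real (n + 2) * (\<xi> 1)\<^sup>2 \<le> 3 * real n * (\<xi> 1)\<^sup>2"
        using elim by (intro mult_right_mono) auto
      then show "4 * (\<Sum>k = 1..n + 2. (\<xi> k)\<^sup>2) \<le> 12 * real n * (\<xi> 1)\<^sup>2"
        using sum_squares_le_first[OF assms, of "n + 2"] by simp
      have "1 \<le> (real n + 3)\<^sup>2 - 1" by (simp add: power2_sum)
      then have "pi\<^sup>2 * (\<xi> (n + 3))\<^sup>2 / ((real n + 3)\<^sup>2 - 1) \<le> pi\<^sup>2 * (\<xi> (n + 3))\<^sup>2 / 1"
        by (intro divide_left_mono) auto
      also have "\<dots> \<le> pi\<^sup>2 * (\<xi> 1)\<^sup>2 * 1"
        using positive_antimono_square_le[OF assms, of 1 "n + 3"] by (simp add: mult_left_mono)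
      also have "\<dots> \<le> pi\<^sup>2 * (\<xi> 1)\<^sup>2 * real n"
        using elim by (intro mult_left_mono) auto
      finally show "pi\<^sup>2 * (\<xi> (n + 3))\<^sup>2 / ((real n + 3)\<^sup>2 - 1) \<le> pi\<^sup>2 * (\<xi> 1)\<^sup>2 * real n" .
    qed
    also have "\<dots> = (12 + pi\<^sup>2) * (\<xi> 1)\<^sup>2 * real n" by (simp add: algebra_simps)
    finally show ?case
      by (simp add: real_le_rsqrt abs_of_nonneg ell2_norm_def infsum_nonneg flip: real_sqrt_mult)
  qed
qed

theorem theorem2:
  fixes \<xi> :: "nat \<Rightarrow> real"
  assumes pos: "\<forall>k\<ge>1. \<xi> k > 0"
    and dec: "antimono_on {1..} \<xi>"
  shows "(\<forall>n\<ge>8.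
        3 * (real n - 7) * (\<xi> (n + 2))\<^sup>2 \<le> 3 * (\<Sum>k = 10..n + 2. (\<xi> k)\<^sup>2)
      \<and> 3 * (\<Sum>k = 10..n + 2. (\<xi> k)\<^sup>2) \<le> (ell2_norm ((R_op \<xi> ^^ s_num n) (\<lambda>_. 0)))\<^sup>2
      \<and> (ell2_norm ((R_op \<xi> ^^ s_num n) (\<lambda>_. 0)))\<^sup>2
          < 4 * (\<Sum>k = 1..n + 2. (\<xi> k)\<^sup>2) + pi\<^sup>2 * (\<xi> (n + 3))\<^sup>2 / ((real n + 3)\<^sup>2 - 1)
      \<and> 4 * (\<Sum>k = 1..n + 2. (\<xi> k)\<^sup>2) + pi\<^sup>2 * (\<xi> (n + 3))\<^sup>2 / ((real n + 3)\<^sup>2 - 1)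
          \<le> 4 * (real n + 2) * (\<xi> 1)\<^sup>2 + pi\<^sup>2 * (\<xi> (n + 3))\<^sup>2 / ((real n + 3)\<^sup>2 - 1))
    \<and> ((\<exists>L>0. \<xi> \<longlonglongrightarrow> L) \<longrightarrow> \<xi> \<notin> ell2)
    \<and> (\<xi> \<notin> ell2 \<longrightarrow>
        filterlim (\<lambda>n. ell2_norm ((R_op \<xi> ^^ s_num n) (\<lambda>_. 0))) at_top sequentially)
    \<and> ((\<exists>L>0. \<xi> \<longlonglongrightarrow> L) \<longrightarrow>
        (\<lambda>n. ell2_norm ((R_op \<xi> ^^ s_num n) (\<lambda>_. 0))) \<in> O(\<lambda>n. sqrt (real n)))"
proof (intro conjI allI impI)
  fix n :: nat
  assume n: "8 \<le> n"
  have "real (card {10..n + 2}) * (\<xi> (n + 2))\<^sup>2 \<le> (\<Sum>k = 10..n + 2. (\<xi> k)\<^sup>2)"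
    by (rule sum_bounded_below) (use positive_antimono_square_le[OF pos dec] in auto)
  moreover have "real (card {10..n + 2}) = real n - 7" using n by simp
  ultimately have "(real n - 7) * (\<xi> (n + 2))\<^sup>2 \<le> (\<Sum>k = 10..n + 2. (\<xi> k)\<^sup>2)"
    by (simp only:)
  then show "3 * (real n - 7) * (\<xi> (n + 2))\<^sup>2 \<le> 3 * (\<Sum>k = 10..n + 2. (\<xi> k)\<^sup>2)"
    by linarith
  show "3 * (\<Sum>k = 10..n + 2. (\<xi> k)\<^sup>2) \<le> (ell2_norm ((R_op \<xi> ^^ s_num n) (\<lambda>_. 0)))\<^sup>2"
    by (rule ell2_norm_orbit_lower[OF pos dec])
  show "(ell2_norm ((R_op \<xi> ^^ s_num n) (\<lambda>_. 0)))\<^sup>2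
      < 4 * (\<Sum>k = 1..n + 2. (\<xi> k)\<^sup>2) + pi\<^sup>2 * (\<xi> (n + 3))\<^sup>2 / ((real n + 3)\<^sup>2 - 1)"
    by (rule ell2_norm_orbit_upper[OF pos dec])
  show "4 * (\<Sum>k = 1..n + 2. (\<xi> k)\<^sup>2) + pi\<^sup>2 * (\<xi> (n + 3))\<^sup>2 / ((real n + 3)\<^sup>2 - 1)
      \<le> 4 * (real n + 2) * (\<xi> 1)\<^sup>2 + pi\<^sup>2 * (\<xi> (n + 3))\<^sup>2 / ((real n + 3)\<^sup>2 - 1)"
  proof -
    have "real (n + 2) = real n + 2" by simp
    then have "(\<Sum>k = 1..n + 2. (\<xi> k)\<^sup>2) \<le> (real n + 2) * (\<xi> 1)\<^sup>2"
      using sum_squares_le_first[OF pos dec, of "n + 2"] by (simp only:)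
    then show ?thesis
      by (simp only: mult.assoc)
  qed
next
  assume "\<exists>L>0. \<xi> \<longlonglongrightarrow> L"
  then show "\<xi> \<notin> ell2" using positive_limit_not_in_ell2 by blast
next
  assume "\<xi> \<notin> ell2"
  then show "filterlim (\<lambda>n. ell2_norm ((R_op \<xi> ^^ s_num n) (\<lambda>_. 0))) at_top sequentially"
    by (rule ell2_norm_orbit_at_top[OF pos dec])
next
  show "(\<lambda>n. ell2_norm ((R_op \<xi> ^^ s_num n) (\<lambda>_. 0))) \<in> O(\<lambda>n. sqrt (real n))"
    by (rule ell2_norm_orbit_bigo[OF pos dec])
qed

end
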